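(* Let $A,B,C$ be Hermitian $N\times N$ complex matrices satisfying $[A,B]=AB-BA=iC$. Let $a\in\mathbb{R}$ and let $\phi_a\in\mathbb{C}^N$ be such that $A\phi_a=a\phi_a$. Then $\operatorname{tr}(C)=0$ and $\langle\phi_a,C\phi_a\rangle=0$.
   Context: $\mathbb{C}^N$ carries its standard Hermitian inner product $\langle\cdot,\cdot\rangle$. *)

theory Defs
  imports "HOL-Analysis.Analysis"
begin

definition conj_transpose :: "complex ^ 'n ^ 'm \<Rightarrow> complex ^ 'm ^ 'n" where
  "conj_transpose M = (\<chi> i j. cnj (M $ j $ i))"

definition hermitian :: "complex ^ 'n ^ 'n \<Rightarrow> bool" where
  "hermitian M \<longleftrightarrow> conj_transpose M = M"

(* The library's inner product on complex ^ 'n is real-valued: it is the real part of this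
   Hermitian one, which is conjugate-linear in its first argument. *)
definition cinner :: "complex ^ 'n \<Rightarrow> complex ^ 'n \<Rightarrow> complex" where
  "cinner x y = (\<Sum>i\<in>UNIV. cnj (x $ i) * y $ i)"

(* ( *\<^sub>R) scales matrices only by reals, and ( *s) does not reach matrix entries. *)
definition cscale_mat :: "complex \<Rightarrow> complex ^ 'n ^ 'm \<Rightarrow> complex ^ 'n ^ 'm" where
  "cscale_mat c M = (\<chi> i j. c * M $ i $ j)"

definition commutator :: "complex ^ 'n ^ 'n \<Rightarrow> complex ^ 'n ^ 'n \<Rightarrow> complex ^ 'n ^ 'n" where
  "commutator A B = A ** B - B ** A"

end

theory Submission
  imports Defs
begin

text \<open>Trace and the form \<open>cinner \<phi> (M *v \<phi>)\<close> are both complex linear in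
  the matrix M, so it suffices that they vanish on the commutator, which is a nonzero multiple of C.
  The trace does because AB and BA have equal trace (\<open>trace_commutator\<close>); the form does
  because A acts as the same real scalar on either side of the inner product
  (\<open>cinner_commutator_eigenvector\<close>).\<close>

lemma trace_commutator: "trace (commutator A B) = 0"
  by (simp add: commutator_def trace_sub trace_mul_sym[of A B])

lemma trace_cscale_mat: "trace (cscale_mat c M) = c * trace M"
  by (simp add: trace_def cscale_mat_def sum_distrib_left)

lemma cscale_mat_vector_mult: "cscale_mat c M *v x = c *s (M *v x)"
  by (simp add: vec_eq_iff matrix_vector_mult_def cscale_mat_def sum_distrib_left mult.assoc)

lemma cinner_diff_right: "cinner x (y - z) = cinner x y - cinner x z"
  by (simp add: cinner_def right_diff_distrib sum_subtractf)

lemma cinner_scale_right: "cinner x (c *s y) = c * cinner x y"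
  by (simp add: cinner_def sum_distrib_left mult_ac)

lemma cinner_scale_left: "cinner (c *s x) y = cnj c * cinner x y"
  by (simp add: cinner_def sum_distrib_left mult_ac)

text \<open>Both sides are the same double sum, summed in opposite orders. For Hermitian M this
  moves M freely across the inner product.\<close>

lemma cinner_adjoint: "cinner x (M *v y) = cinner (conj_transpose M *v x) y"
proof -
  have "cinner x (M *v y) = (\<Sum>i\<in>UNIV. \<Sum>j\<in>UNIV. cnj (x $ i) * M $ i $ j * y $ j)"
    by (simp add: cinner_def matrix_vector_mult_def sum_distrib_left mult.assoc)
  also have "\<dots> = (\<Sum>j\<in>UNIV. \<Sum>i\<in>UNIV. cnj (x $ i) * M $ i $ j * y $ j)"
    by (rule sum.swap)
  also have "\<dots> = cinner (conj_transpose M *v x) y"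
    by (simp add: cinner_def matrix_vector_mult_def conj_transpose_def sum_distrib_left mult_ac)
  finally show ?thesis .
qed

lemma cinner_commutator_eigenvector:
  assumes "hermitian A" and "A *v \<phi> = complex_of_real a *s \<phi>"
  shows "cinner \<phi> (commutator A B *v \<phi>) = 0"
proof -
  have "cinner \<phi> (commutator A B *v \<phi>) = cinner \<phi> (A *v (B *v \<phi>)) - cinner \<phi> (B *v (A *v \<phi>))"
    by (simp add: commutator_def matrix_vector_mult_diff_rdistrib cinner_diff_right
        matrix_vector_mul_assoc)
  also have "cinner \<phi> (A *v (B *v \<phi>)) = cinner (A *v \<phi>) (B *v \<phi>)"
    using assms(1) by (simp add: cinner_adjoint[of \<phi> A] hermitian_def)
  \<comment> \<open>Both terms equal \<open>a * cinner \<phi> (B *v \<phi>)\<close>: in the first,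
    the scalar leaves the left slot conjugated, which is harmless as \<open>a\<close> is real; in
    the second, it is pulled through B.\<close>
  finally show ?thesis
    by (simp add: assms(2) cinner_scale_left cinner_scale_right vector_scalar_commute)
qed

theorem theorem1p1:
  fixes A B C :: "complex ^ 'n ^ 'n"
    and a :: real
    and \<phi> :: "complex ^ 'n"
  assumes "hermitian A" and "hermitian B" and "hermitian C"
    and "commutator A B = cscale_mat \<i> C"
    and "A *v \<phi> = complex_of_real a *s \<phi>"
  shows "trace C = 0 \<and> cinner \<phi> (C *v \<phi>) = 0"
proof
  show "trace C = 0"
    \<comment> \<open>The fact becomes \<open>\<i> * trace C = 0\<close>, and the factor
      \<open>\<i>\<close> cancels.\<close>
    using trace_commutator[of A B] by (simp add: assms(4) trace_cscale_mat)
  show "cinner \<phi> (C *v \<phi>) = 0"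
    using cinner_commutator_eigenvector[OF assms(1,5), of B]
    by (simp add: assms(4) cscale_mat_vector_mult cinner_scale_right)
qed

end
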